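(* Let $\mathcal P$ be an operad in $\mathbb F_2$-vector spaces and $\star\in\mathcal P(2)^{\mathfrak S_2}$. Every $\star$-unstable $\mathcal P$-algebra $M$ is $\star$-compatible, that is, for all $n$, all $\mu\in\mathcal P(n)$ and all $a_1,\dots,a_n\in M$, $$\star(\mu(a_1,\dots,a_n),\mu(a_1,\dots,a_n))=\mu(\star(a_1,a_1),\dots,\star(a_n,a_n)).$$
   Context: Base field $\mathbb F=\mathbb F_2$. $\mathcal A$ is the mod 2 Steenrod algebra ($Sq^0=1$). $\mathcal U$ is the category of unstable modules: graded left $\mathcal A$-modules $M$ with $Sq^ix=0$ for $i>|x|$; $Sq_0x:=Sq^{|x|}x$ for homogeneous $x$, extended additively. Operads are symmetric operads in $\mathbb F$-vector spaces, regarded as concentrated in degree $0$. A $\mathcal P$-algebra in $\mathcal U$ is an algebra over the monad $S(\mathcal P,M)=\bigoplus_{n\ge0}\mathcal P(n)\otimes_{\mathfrak S_n}M^{\otimes n}$ on $\mathcal U$, where tensor products carry the action $Sq^i(x\otimes y)=\sum_{k+l=i}Sq^kx\otimes Sq^ly$. A $\star$-unstable $\mathcal P$-algebra is a $\mathcal P$-algebra $M$ in $\mathcal U$ with $Sq_0x=\star(x,x)$ for all $x\in M$. *)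

theory Defs
  imports
    "HOL-Algebra.Module"
    "HOL-Library.Z2"
    "HOL-Library.Poly_Mapping"
    "HOL-Combinatorics.Permutations"
begin

section \<open>Vector spaces over the field with two elements\<close>

text \<open>
  Vector spaces are modules, in the sense of HOL-Algebra, over the ring record of the field
  \<^typ>\<open>bit\<close>. The multiplicative fields of a module record carry no information.
\<close>

definition F2 :: "bit ring" where
  "F2 = \<lparr>carrier = UNIV, monoid.mult = (*), one = 1, zero = 0, add = (+)\<rparr>"

abbreviation vec_space :: "(bit, 'v, 'e) module_scheme \<Rightarrow> bool" where
  "vec_space V \<equiv> Module.module F2 V"

definition linear_map ::
    "(bit, 'v, 'e) module_scheme \<Rightarrow> (bit, 'w, 'f) module_scheme \<Rightarrow> ('v \<Rightarrow> 'w) \<Rightarrow> bool" where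
  "linear_map V W f \<longleftrightarrow>
     f \<in> carrier V \<rightarrow> carrier W \<and>
     (\<forall>x\<in>carrier V. \<forall>y\<in>carrier V. f (x \<oplus>\<^bsub>V\<^esub> y) = f x \<oplus>\<^bsub>W\<^esub> f y) \<and>
     (\<forall>c. \<forall>x\<in>carrier V. f (c \<odot>\<^bsub>V\<^esub> x) = c \<odot>\<^bsub>W\<^esub> f x)"

section \<open>Unstable modules over the Steenrod algebra\<close>

text \<open>
  A graded vector space is the direct sum of its homogeneous parts \<open>gr M d\<close>. The grading is by
  natural numbers: an unstable module vanishes in negative degrees, since \<open>Sq\<^sup>0 = 1\<close>.
\<close>

record 'm sq_module = "(bit, 'm) module" +
  gr :: "nat \<Rightarrow> 'm set"
  Sq :: "nat \<Rightarrow> 'm \<Rightarrow> 'm"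

definition homogeneous_decomposition :: "'m sq_module \<Rightarrow> 'm \<Rightarrow> (nat \<Rightarrow> 'm) \<Rightarrow> bool" where
  "homogeneous_decomposition M x f \<longleftrightarrow>
     (\<forall>d. f d \<in> gr M d) \<and> finite {d. f d \<noteq> \<zero>\<^bsub>M\<^esub>} \<and> x = finsum M f {d. f d \<noteq> \<zero>\<^bsub>M\<^esub>}"

locale graded_space =
  fixes M :: "'m sq_module"
  assumes vec_space: "vec_space M"
    and gr_submodule: "submodule (gr M d) F2 M"
    and direct_sum: "x \<in> carrier M \<Longrightarrow> \<exists>!f. homogeneous_decomposition M x f"

text \<open>
  The mod 2 Steenrod algebra is the associative unital algebra over the field with two elements
  generated by the symbols \<open>Sq\<^sup>i\<close> subject to \<open>Sq\<^sup>0 = 1\<close> and to the Adem relations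
  \<open>Sq\<^sup>a Sq\<^sup>b = \<Sum>c \<le> a/2. (b - c - 1 choose a - 2c) Sq\<^sup>a\<^sup>+\<^sup>b\<^sup>-\<^sup>c Sq\<^sup>c\<close> for \<open>0 < a < 2b\<close>. A graded left module
  over it is therefore a graded vector space with linear operations \<open>Sq\<^sup>i\<close> of degree \<open>i\<close>
  that satisfy these relations. The natural number subtractions below are exact,
  because \<open>c \<le> a div 2 < b\<close>.
\<close>

locale steenrod_module = graded_space M for M :: "'m sq_module" +
  assumes Sq_linear: "linear_map M M (Sq M i)"
    and Sq_degree: "x \<in> gr M d \<Longrightarrow> Sq M i x \<in> gr M (d + i)"
    and Sq_zero: "x \<in> carrier M \<Longrightarrow> Sq M 0 x = x"
    and adem: "\<lbrakk>0 < a; a < 2 * b; x \<in> carrier M\<rbrakk> \<Longrightarrow>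
      Sq M a (Sq M b x) =
        (\<Oplus>\<^bsub>M\<^esub>c\<in>{..a div 2}.
          (of_nat ((b - c - 1) choose (a - 2 * c)) :: bit) \<odot>\<^bsub>M\<^esub> Sq M (a + b - c) (Sq M c x))"

locale unstable_module = steenrod_module M for M :: "'m sq_module" +
  assumes unstable: "\<lbrakk>x \<in> gr M d; d < i\<rbrakk> \<Longrightarrow> Sq M i x = \<zero>\<^bsub>M\<^esub>"

text \<open>On a homogeneous \<open>x\<close> of degree \<open>d\<close>, \<open>Sq\<^sub>0 x\<close> is \<open>Sq\<^sup>d x\<close>; this is extended additively.\<close>

definition hom_part :: "'m sq_module \<Rightarrow> 'm \<Rightarrow> nat \<Rightarrow> 'm" where
  "hom_part M x = (THE f. homogeneous_decomposition M x f)"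

definition Sq_lower_0 :: "'m sq_module \<Rightarrow> 'm \<Rightarrow> 'm" where
  "Sq_lower_0 M x = (\<Oplus>\<^bsub>M\<^esub>d\<in>{d. hom_part M x d \<noteq> \<zero>\<^bsub>M\<^esub>}. Sq M d (hom_part M x d))"

text \<open>Linearity over the Steenrod algebra only has to be required for the generators \<open>Sq\<^sup>i\<close>.\<close>

definition sq_module_hom :: "'m sq_module \<Rightarrow> 'n sq_module \<Rightarrow> ('m \<Rightarrow> 'n) \<Rightarrow> bool" where
  "sq_module_hom M N f \<longleftrightarrow>
     linear_map M N f \<and>
     (\<forall>d. f ` gr M d \<subseteq> gr N d) \<and>
     (\<forall>i. \<forall>x\<in>carrier M. f (Sq M i x) = Sq N i (f x))"

section \<open>Symmetric operads\<close>

text \<open>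
  \<open>ops P n\<close> is the space of \<open>n\<close>-ary operations, and \<open>act P n \<mu> \<sigma> = \<mu> \<cdot> \<sigma>\<close> is the right action of
  the permutations of \<open>{..<n}\<close> on it. If \<open>\<mu>\<close> has arity \<open>n\<close> and \<open>\<nu>\<^sub>i\<close> has arity \<open>k\<^sub>i\<close>, then
  \<open>compo P [k\<^sub>0, \<dots>, k\<^sub>n\<^sub>-\<^sub>1] \<mu> [\<nu>\<^sub>0, \<dots>, \<nu>\<^sub>n\<^sub>-\<^sub>1]\<close> is the full composite \<open>\<gamma>(\<mu>; \<nu>\<^sub>0, \<dots>, \<nu>\<^sub>n\<^sub>-\<^sub>1)\<close>. The
  arities are arguments because the carriers of \<open>ops P n\<close> for different \<open>n\<close> need not be disjoint.
\<close>

record 'p operad =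
  ops :: "nat \<Rightarrow> (bit, 'p) module"
  act :: "nat \<Rightarrow> 'p \<Rightarrow> (nat \<Rightarrow> nat) \<Rightarrow> 'p"
  unit_op :: "'p"
  compo :: "nat list \<Rightarrow> 'p \<Rightarrow> 'p list \<Rightarrow> 'p"

definition ops_list :: "'p operad \<Rightarrow> nat list \<Rightarrow> 'p list \<Rightarrow> bool" where
  "ops_list P ks \<nu>s \<longleftrightarrow> list_all2 (\<lambda>k \<nu>. \<nu> \<in> carrier (ops P k)) ks \<nu>s"

text \<open>
  The set of the first \<open>sum_list ks\<close> natural numbers is cut into consecutive blocks of sizes \<open>ks\<close>;
  \<open>block_pos ks i j\<close> is the \<open>j\<close>-th place of the \<open>i\<close>-th block.
\<close>

definition block_pos :: "nat list \<Rightarrow> nat \<Rightarrow> nat \<Rightarrow> nat" where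
  "block_pos ks i j = sum_list (take i ks) + j"

text \<open>
  A permutation \<open>\<sigma>\<close> acts on lists from the left by moving the entry at place \<open>i\<close> to place \<open>\<sigma> i\<close>,
  that is, by \<open>(\<sigma> \<cdot> a)\<^sub>i = a\<^bsub>\<sigma>\<^sup>-\<^sup>1(i)\<^esub>\<close>.
\<close>

definition move :: "(nat \<Rightarrow> nat) \<Rightarrow> 'a list \<Rightarrow> 'a list" where
  "move \<sigma> xs = permute_list (inv_into UNIV \<sigma>) xs"

text \<open>
  The next two predicates determine \<open>\<rho>\<close> uniquely: the first says that \<open>\<rho>\<close> moves the blocks of
  sizes \<open>ks\<close> as \<open>\<sigma>\<close> moves single places, the second that \<open>\<rho>\<close> is the block sum of the \<open>\<tau>s\<close>.
\<close>

definition block_permutation :: "(nat \<Rightarrow> nat) \<Rightarrow> nat list \<Rightarrow> (nat \<Rightarrow> nat) \<Rightarrow> bool" where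
  "block_permutation \<sigma> ks \<rho> \<longleftrightarrow>
     \<rho> permutes {..<sum_list ks} \<and>
     (\<forall>i<length ks. \<forall>j<ks ! i. \<rho> (block_pos ks i j) = block_pos (move \<sigma> ks) (\<sigma> i) j)"

definition block_sum :: "nat list \<Rightarrow> (nat \<Rightarrow> nat) list \<Rightarrow> (nat \<Rightarrow> nat) \<Rightarrow> bool" where
  "block_sum ks \<tau>s \<rho> \<longleftrightarrow>
     \<rho> permutes {..<sum_list ks} \<and>
     (\<forall>i<length ks. \<forall>j<ks ! i. \<rho> (block_pos ks i j) = block_pos ks i ((\<tau>s ! i) j))"

locale symmetric_operad =
  fixes P :: "'p operad"
  assumes ops_vec_space: "vec_space (ops P n)"
    and act_linear: "\<sigma> permutes {..<n} \<Longrightarrow> linear_map (ops P n) (ops P n) (\<lambda>\<mu>. act P n \<mu> \<sigma>)"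
    and act_id: "\<mu> \<in> carrier (ops P n) \<Longrightarrow> act P n \<mu> id = \<mu>"
    and act_comp: "\<lbrakk>\<mu> \<in> carrier (ops P n); \<sigma> permutes {..<n}; \<tau> permutes {..<n}\<rbrakk> \<Longrightarrow>
      act P n \<mu> (\<sigma> \<circ> \<tau>) = act P n (act P n \<mu> \<sigma>) \<tau>"
    and unit_closed: "unit_op P \<in> carrier (ops P 1)"
    and compo_linear_outer: "ops_list P ks \<nu>s \<Longrightarrow>
      linear_map (ops P (length ks)) (ops P (sum_list ks)) (\<lambda>\<mu>. compo P ks \<mu> \<nu>s)"
    and compo_linear_inner:
      "\<lbrakk>\<mu> \<in> carrier (ops P (length ks)); ops_list P ks \<nu>s; i < length ks\<rbrakk> \<Longrightarrow>
      linear_map (ops P (ks ! i)) (ops P (sum_list ks)) (\<lambda>\<nu>. compo P ks \<mu> (\<nu>s[i := \<nu>]))"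
    and unit_left: "\<mu> \<in> carrier (ops P n) \<Longrightarrow> compo P [n] (unit_op P) [\<mu>] = \<mu>"
    and unit_right: "\<mu> \<in> carrier (ops P n) \<Longrightarrow>
      compo P (replicate n 1) \<mu> (replicate n (unit_op P)) = \<mu>"
    and assoc:
      "\<lbrakk>\<mu> \<in> carrier (ops P (length kss)); ops_list P (map length kss) \<nu>s;
        list_all2 (ops_list P) kss \<xi>ss\<rbrakk> \<Longrightarrow>
      compo P (concat kss) (compo P (map length kss) \<mu> \<nu>s) (concat \<xi>ss) =
      compo P (map sum_list kss) \<mu>
        (map (\<lambda>(ks, \<nu>, \<xi>s). compo P ks \<nu> \<xi>s) (zip kss (zip \<nu>s \<xi>ss)))"
    and equivariant_outer:
      "\<lbrakk>\<mu> \<in> carrier (ops P (length ks)); ops_list P ks \<nu>s; \<sigma> permutes {..<length ks};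
        block_permutation \<sigma> ks \<rho>\<rbrakk> \<Longrightarrow>
      compo P ks (act P (length ks) \<mu> \<sigma>) \<nu>s =
      act P (sum_list ks) (compo P (move \<sigma> ks) \<mu> (move \<sigma> \<nu>s)) \<rho>"
    and equivariant_inner:
      "\<lbrakk>\<mu> \<in> carrier (ops P (length ks)); ops_list P ks \<nu>s;
        list_all2 (\<lambda>k \<tau>. \<tau> permutes {..<k}) ks \<tau>s; block_sum ks \<tau>s \<rho>\<rbrakk> \<Longrightarrow>
      compo P ks \<mu> (map (\<lambda>(k, \<nu>, \<tau>). act P k \<nu> \<tau>) (zip ks (zip \<nu>s \<tau>s))) =
      act P (sum_list ks) (compo P ks \<mu> \<nu>s) \<rho>"

definition invariants :: "'p operad \<Rightarrow> nat \<Rightarrow> 'p set" where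
  "invariants P n =
     {\<mu> \<in> carrier (ops P n). \<forall>\<sigma>. \<sigma> permutes {..<n} \<longrightarrow> act P n \<mu> \<sigma> = \<mu>}"

section \<open>The monad of an operad\<close>

text \<open>
  \<open>S(P, M) = \<Oplus>n. P(n) \<otimes>\<^bsub>S\<^sub>n\<^esub> M\<^sup>\<otimes>\<^sup>n\<close> is built as a quotient of the vector space with basis the pairs
  \<open>(\<mu>, as)\<close>, where \<open>as\<close> is a list of elements of \<open>M\<close> and \<open>\<mu>\<close> is an operation of arity \<open>length as\<close>.
  One divides by multilinearity and by \<open>(\<mu> \<cdot> \<sigma>) \<otimes> a = \<mu> \<otimes> (\<sigma> \<cdot> a)\<close>; the symmetric group
  permutes the tensor factors without signs.
\<close>

type_synonym ('p, 'm) formal_tensor = "('p \<times> 'm list) \<Rightarrow>\<^sub>0 bit"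

definition basis_tensors :: "'p operad \<Rightarrow> 'm sq_module \<Rightarrow> ('p \<times> 'm list) set" where
  "basis_tensors P M = {(\<mu>, as). \<mu> \<in> carrier (ops P (length as)) \<and> set as \<subseteq> carrier M}"

abbreviation basis_tensor :: "'p \<Rightarrow> 'm list \<Rightarrow> ('p, 'm) formal_tensor" where
  "basis_tensor \<mu> as \<equiv> Poly_Mapping.single (\<mu>, as) 1"

text \<open>Over the field with two elements, closure under sums makes this a subspace.\<close>

inductive_set tensor_relations :: "'p operad \<Rightarrow> 'm sq_module \<Rightarrow> ('p, 'm) formal_tensor set"
  for P :: "'p operad" and M :: "'m sq_module" where
  zero: "0 \<in> tensor_relations P M"
| sum: "\<lbrakk>r \<in> tensor_relations P M; s \<in> tensor_relations P M\<rbrakk> \<Longrightarrow> r + s \<in> tensor_relations P M"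
| add_op: "\<lbrakk>\<mu> \<in> carrier (ops P (length as)); \<nu> \<in> carrier (ops P (length as));
      set as \<subseteq> carrier M\<rbrakk> \<Longrightarrow>
    basis_tensor (\<mu> \<oplus>\<^bsub>ops P (length as)\<^esub> \<nu>) as - basis_tensor \<mu> as - basis_tensor \<nu> as
      \<in> tensor_relations P M"
| smult_op: "\<lbrakk>\<mu> \<in> carrier (ops P (length as)); set as \<subseteq> carrier M\<rbrakk> \<Longrightarrow>
    basis_tensor (c \<odot>\<^bsub>ops P (length as)\<^esub> \<mu>) as - Poly_Mapping.single (\<mu>, as) c
      \<in> tensor_relations P M"
| add_arg: "\<lbrakk>\<mu> \<in> carrier (ops P (length as)); set as \<subseteq> carrier M; i < length as;
      x \<in> carrier M; y \<in> carrier M\<rbrakk> \<Longrightarrow>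
    basis_tensor \<mu> (as[i := x \<oplus>\<^bsub>M\<^esub> y]) - basis_tensor \<mu> (as[i := x]) - basis_tensor \<mu> (as[i := y])
      \<in> tensor_relations P M"
| smult_arg: "\<lbrakk>\<mu> \<in> carrier (ops P (length as)); set as \<subseteq> carrier M; i < length as;
      x \<in> carrier M\<rbrakk> \<Longrightarrow>
    basis_tensor \<mu> (as[i := c \<odot>\<^bsub>M\<^esub> x]) - Poly_Mapping.single (\<mu>, as[i := x]) c
      \<in> tensor_relations P M"
| coinvariant: "\<lbrakk>\<mu> \<in> carrier (ops P (length as)); set as \<subseteq> carrier M;
      \<sigma> permutes {..<length as}\<rbrakk> \<Longrightarrow>
    basis_tensor (act P (length as) \<mu> \<sigma>) as - basis_tensor \<mu> (move \<sigma> as)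
      \<in> tensor_relations P M"

definition tensor_class ::
    "'p operad \<Rightarrow> 'm sq_module \<Rightarrow> ('p, 'm) formal_tensor \<Rightarrow> ('p, 'm) formal_tensor set" where
  "tensor_class P M u = {u + r | r. r \<in> tensor_relations P M}"

text \<open>
  The structure of the quotient is defined on chosen representatives; the result does not depend
  on the choice.
\<close>

definition rep :: "'a set \<Rightarrow> 'a" where
  "rep X = (SOME u. u \<in> X)"

text \<open>The linear extension of a function given on basis elements: all nonzero coefficients are 1.\<close>

definition linear_extension :: "('a \<Rightarrow> ('b \<Rightarrow>\<^sub>0 bit)) \<Rightarrow> ('a \<Rightarrow>\<^sub>0 bit) \<Rightarrow> ('b \<Rightarrow>\<^sub>0 bit)" where
  "linear_extension f u = (\<Sum>g\<in>Poly_Mapping.keys u. f g)"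

text \<open>
  Operads are concentrated in degree 0. Iterating the Cartan formula, \<open>Sq\<^sup>i\<close> sends
  \<open>\<mu> \<otimes> a\<^sub>1 \<otimes> \<dots> \<otimes> a\<^sub>n\<close> to the sum of \<open>\<mu> \<otimes> Sq\<^bsup>k\<^sub>1\<^esup> a\<^sub>1 \<otimes> \<dots> \<otimes> Sq\<^bsup>k\<^sub>n\<^esup> a\<^sub>n\<close> over \<open>k\<^sub>1 + \<dots> + k\<^sub>n = i\<close>;
  for \<open>n = 0\<close> this says that \<open>Sq\<^sup>0\<close> is the identity and that the other \<open>Sq\<^sup>i\<close> vanish.
\<close>

definition cartan_Sq :: "'m sq_module \<Rightarrow> nat \<Rightarrow> 'p \<times> 'm list \<Rightarrow> ('p, 'm) formal_tensor" where
  "cartan_Sq M i = (\<lambda>(\<mu>, as).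
     \<Sum>ks\<in>{ks. length ks = length as \<and> sum_list ks = i}. basis_tensor \<mu> (map2 (Sq M) ks as))"

definition homogeneous_tensors :: "'p operad \<Rightarrow> 'm sq_module \<Rightarrow> nat \<Rightarrow> ('p \<times> 'm list) set" where
  "homogeneous_tensors P M d =
     {(\<mu>, as). \<mu> \<in> carrier (ops P (length as)) \<and>
        (\<exists>ds. list_all2 (\<lambda>e a. a \<in> gr M e) ds as \<and> sum_list ds = d)}"

definition schur :: "'p operad \<Rightarrow> 'm sq_module \<Rightarrow> ('p, 'm) formal_tensor set sq_module" where
  "schur P M =
     \<lparr>carrier = tensor_class P M ` {u. Poly_Mapping.keys u \<subseteq> basis_tensors P M},
      monoid.mult = undefined,
      one = undefined,
      zero = tensor_class P M 0,
      add = (\<lambda>X Y. tensor_class P M (rep X + rep Y)),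
      smult = (\<lambda>c X. tensor_class P M (Poly_Mapping.map ((*) c) (rep X))),
      gr = (\<lambda>d. tensor_class P M ` {u. Poly_Mapping.keys u \<subseteq> homogeneous_tensors P M d}),
      Sq = (\<lambda>i X. tensor_class P M (linear_extension (cartan_Sq M i) (rep X)))\<rparr>"

definition schur_map :: "'p operad \<Rightarrow> 'm sq_module \<Rightarrow> 'n sq_module \<Rightarrow> ('m \<Rightarrow> 'n) \<Rightarrow>
    ('p, 'm) formal_tensor set \<Rightarrow> ('p, 'n) formal_tensor set" where
  "schur_map P M N f X =
     tensor_class P N (linear_extension (\<lambda>(\<mu>, as). basis_tensor \<mu> (map f as)) (rep X))"

definition schur_unit :: "'p operad \<Rightarrow> 'm sq_module \<Rightarrow> 'm \<Rightarrow> ('p, 'm) formal_tensor set" where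
  "schur_unit P M x = tensor_class P M (basis_tensor (unit_op P) [x])"

text \<open>
  The monad multiplication \<open>S(P, S(P, M)) \<rightarrow> S(P, M)\<close> sends
  \<open>\<mu> \<otimes> (\<nu>\<^sub>1 \<otimes> as\<^sub>1) \<otimes> \<dots> \<otimes> (\<nu>\<^sub>n \<otimes> as\<^sub>n)\<close> to \<open>\<gamma>(\<mu>; \<nu>\<^sub>1, \<dots>, \<nu>\<^sub>n) \<otimes> as\<^sub>1 \<otimes> \<dots> \<otimes> as\<^sub>n\<close>. A factor that is a
  sum of tensors \<open>\<nu> \<otimes> as\<close> is expanded, which is the sum over \<open>listset\<close>.
\<close>

definition flatten :: "'p operad \<Rightarrow> 'p \<Rightarrow> ('p \<times> 'm list) list \<Rightarrow> ('p, 'm) formal_tensor" where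
  "flatten P \<mu> gs =
     basis_tensor (compo P (map (length \<circ> snd) gs) \<mu> (map fst gs)) (concat (map snd gs))"

definition schur_mult :: "'p operad \<Rightarrow> 'm sq_module \<Rightarrow>
    ('p, ('p, 'm) formal_tensor set) formal_tensor set \<Rightarrow> ('p, 'm) formal_tensor set" where
  "schur_mult P M Z =
     tensor_class P M
       (linear_extension
         (\<lambda>(\<mu>, Xs). \<Sum>gs\<in>listset (map (\<lambda>X. Poly_Mapping.keys (rep X)) Xs). flatten P \<mu> gs)
         (rep Z))"

section \<open>Algebras\<close>

locale unstable_algebra = symmetric_operad P + unstable_module M
  for P :: "'p operad" and M :: "'m sq_module" +
  fixes \<theta> :: "('p, 'm) formal_tensor set \<Rightarrow> 'm"
  assumes structure_hom: "sq_module_hom (schur P M) M \<theta>"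
    and structure_unit: "x \<in> carrier M \<Longrightarrow> \<theta> (schur_unit P M x) = x"
    and structure_mult: "Z \<in> carrier (schur P (schur P M)) \<Longrightarrow>
      \<theta> (schur_map P (schur P M) M \<theta> Z) = \<theta> (schur_mult P M Z)"

text \<open>The operation \<open>\<mu>(a\<^sub>1, \<dots>, a\<^sub>n)\<close> on an algebra with structure map \<open>\<theta>\<close>.\<close>

definition op_apply :: "'p operad \<Rightarrow> 'm sq_module \<Rightarrow> (('p, 'm) formal_tensor set \<Rightarrow> 'm) \<Rightarrow>
    'p \<Rightarrow> 'm list \<Rightarrow> 'm" where
  "op_apply P M \<theta> \<mu> as = \<theta> (tensor_class P M (basis_tensor \<mu> as))"

locale star_unstable_algebra = unstable_algebra P M \<theta>
  for P :: "'p operad" and star :: 'p and M :: "'m sq_module"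
    and \<theta> :: "('p, 'm) formal_tensor set \<Rightarrow> 'm" +
  assumes star_unstable: "x \<in> carrier M \<Longrightarrow> Sq_lower_0 M x = op_apply P M \<theta> star [x, x]"

definition star_compatible :: "'p operad \<Rightarrow> 'p \<Rightarrow> 'm sq_module \<Rightarrow>
    (('p, 'm) formal_tensor set \<Rightarrow> 'm) \<Rightarrow> bool" where
  "star_compatible P star M \<theta> \<longleftrightarrow>
     (\<forall>n. \<forall>\<mu>\<in>carrier (ops P n). \<forall>as. length as = n \<and> set as \<subseteq> carrier M \<longrightarrow>
        op_apply P M \<theta> star [op_apply P M \<theta> \<mu> as, op_apply P M \<theta> \<mu> as] =
        op_apply P M \<theta> \<mu> (map (\<lambda>a. op_apply P M \<theta> star [a, a]) as))"

end

theory Submission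
  imports Defs
begin

text \<open>
  By \<open>\<star>\<close>-instability the claim says that \<open>Sq\<^sub>0\<close> commutes with \<open>\<mu>\<close>. On homogeneous \<open>a\<^sub>i\<close> of degree
  \<open>d\<^sub>i\<close>, the Cartan formula expands \<open>Sq\<^sup>d \<mu>(a\<^sub>1, \<dots>, a\<^sub>n)\<close>, for \<open>d = d\<^sub>1 + \<dots> + d\<^sub>n\<close>, into the terms
  \<open>\<mu>(Sq\<^bsup>k\<^sub>1\<^esup> a\<^sub>1, \<dots>, Sq\<^bsup>k\<^sub>n\<^esup> a\<^sub>n)\<close> with \<open>k\<^sub>1 + \<dots> + k\<^sub>n = d\<close>. Unless \<open>k\<^sub>i = d\<^sub>i\<close> for all \<open>i\<close>, some \<open>k\<^sub>i\<close> exceeds \<open>d\<^sub>i\<close>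
  and the term vanishes by instability. As both sides are additive in each \<open>a\<^sub>i\<close>, this suffices.
\<close>

section \<open>Formal sums over the field with two elements\<close>

lemma poly_mapping_bit_diff:
  fixes u v :: "'a \<Rightarrow>\<^sub>0 bit"
  shows "u - v = u + v"
  by (rule poly_mapping_eqI) (simp add: lookup_minus lookup_add)

lemma poly_mapping_bit_add_self [simp]:
  fixes u :: "'a \<Rightarrow>\<^sub>0 bit"
  shows "u + u = 0"
  by (simp flip: poly_mapping_bit_diff)

text \<open>Cancellation can make the support of a sum smaller than the union of the supports.
  Summing over any finite set containing the support lets several formal sums be compared over one
  index set.\<close>

lemma linear_extension_superset:
  assumes "finite A" "Poly_Mapping.keys u \<subseteq> A"
  shows "linear_extension f u = (\<Sum>g\<in>A. if Poly_Mapping.lookup u g = 0 then 0 else f g)"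
  unfolding linear_extension_def using assms
  by (intro sum.mono_neutral_cong_left) (auto simp: in_keys_iff)

text \<open>The critical case is a basis element \<open>g\<close> lying in both supports: its
  coefficient in \<open>u + v\<close> is 1 + 1 = 0, and correspondingly
  \<open>f g + f g = 0\<close>.\<close>

lemma linear_extension_add:
  "linear_extension f (u + v) = linear_extension f u + linear_extension f v"
proof -
  let ?A = "Poly_Mapping.keys u \<union> Poly_Mapping.keys v"
  have "Poly_Mapping.keys (u + v) \<subseteq> ?A" by (rule keys_add)
  then have "linear_extension f (u + v) =
      (\<Sum>g\<in>?A. if Poly_Mapping.lookup (u + v) g = 0 then 0 else f g)"
    by (intro linear_extension_superset) auto
  also have "\<dots> = (\<Sum>g\<in>?A. (if Poly_Mapping.lookup u g = 0 then 0 else f g) +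
      (if Poly_Mapping.lookup v g = 0 then 0 else f g))"
    by (intro sum.cong) (auto simp: lookup_add)
  also have "\<dots> = linear_extension f u + linear_extension f v"
    unfolding sum.distrib by (intro arg_cong2[where f = "(+)"] linear_extension_superset[symmetric]) auto
  finally show ?thesis .
qed

lemma linear_extension_diff:
  "linear_extension f (u - v) = linear_extension f u - linear_extension f v"
  by (simp add: poly_mapping_bit_diff linear_extension_add)

lemma linear_extension_zero [simp]: "linear_extension f 0 = 0"
  by (simp add: linear_extension_def)

lemma linear_extension_single:
  "linear_extension f (Poly_Mapping.single g c) = (if c = 0 then 0 else f g)"
  by (simp add: linear_extension_def)

section \<open>Classes of tensors\<close>

lemma tensor_relations_sum:
  "(\<And>x. x \<in> A \<Longrightarrow> f x \<in> tensor_relations P M) \<Longrightarrow> sum f A \<in> tensor_relations P M"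
  by (induction A rule: infinite_finite_induct) (auto intro: tensor_relations.zero tensor_relations.sum)

lemma tensor_class_eqI:
  assumes "u - v \<in> tensor_relations P M"
  shows "tensor_class P M u = tensor_class P M v"
proof -
  have "tensor_class P M u \<subseteq> tensor_class P M v"
    if "u - v \<in> tensor_relations P M" for u v
  proof
    fix w assume "w \<in> tensor_class P M u"
    then obtain r where r: "r \<in> tensor_relations P M" "w = u + r"
      by (auto simp: tensor_class_def)
    then have "w = v + ((u - v) + r)" by simp
    moreover have "(u - v) + r \<in> tensor_relations P M"
      using that r(1) by (rule tensor_relations.sum)
    ultimately show "w \<in> tensor_class P M v"
      unfolding tensor_class_def by blast
  qed
  \<comment> \<open>In characteristic 2 both differences are the same formal sum, so the inclusion
    just proved also applies with \<open>u\<close> and \<open>v\<close> exchanged.\<close>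
  moreover have "v - u \<in> tensor_relations P M"
    using assms by (simp add: poly_mapping_bit_diff add.commute)
  ultimately show ?thesis using assms by blast
qed

text \<open>This controls the choice made by \<open>rep\<close>: any map that preserves the
  relations can be computed on \<open>u\<close> itself instead of on the chosen
  representative.\<close>

lemma rep_tensor_class: "rep (tensor_class P M u) - u \<in> tensor_relations P M"
proof -
  have "u \<in> tensor_class P M u"
    unfolding tensor_class_def using tensor_relations.zero by force
  then have "rep (tensor_class P M u) \<in> tensor_class P M u"
    unfolding rep_def by (rule someI)
  then show ?thesis by (auto simp: tensor_class_def)
qed

lemma schur_add:
  "tensor_class P M u \<oplus>\<^bsub>schur P M\<^esub> tensor_class P M v = tensor_class P M (u + v)"
  using tensor_relations.sum[OF rep_tensor_class[of P M u] rep_tensor_class[of P M v]]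
  by (simp add: schur_def algebra_simps tensor_class_eqI)

text \<open>Writing the zero entry as 0 times zero gives an instance of \<open>smult_arg\<close>
  whose second term has coefficient 0 and disappears.\<close>

lemma zero_arg_relation:
  assumes "vec_space M" "\<mu> \<in> carrier (ops P (length as))" "set as \<subseteq> carrier M" "\<zero>\<^bsub>M\<^esub> \<in> set as"
  shows "basis_tensor \<mu> as \<in> tensor_relations P M"
proof -
  interpret V: Module.module F2 M by (rule assms)
  obtain i where i: "i < length as" "as ! i = \<zero>\<^bsub>M\<^esub>"
    using assms by (auto simp: in_set_conv_nth)
  have "as[i := \<zero>\<^bsub>F2\<^esub> \<odot>\<^bsub>M\<^esub> \<zero>\<^bsub>M\<^esub>] = as"
    using i by (simp add: V.smult_l_null) (metis list_update_id)
  moreover have "\<zero>\<^bsub>F2\<^esub> = (0 :: bit)" by (simp add: F2_def)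
  ultimately show ?thesis
    using tensor_relations.smult_arg[OF assms(2,3) i(1), of "\<zero>\<^bsub>M\<^esub>" 0] by simp
qed

section \<open>Exponent lists of the Cartan formula and permutations of their entries\<close>

lemma finite_compositions: "finite {ks :: nat list. length ks = n \<and> sum_list ks = i}"
  by (rule finite_subset[OF _ finite_lists_length_eq[of "{..i}" n]])
    (auto intro: member_le_sum_list)

lemma length_move [simp]: "length (move \<sigma> xs) = length xs"
  by (simp add: move_def)

lemma map2_move:
  assumes "\<sigma> permutes {..<length xs}" "length xs = length ys"
  shows "map2 f (move \<sigma> xs) (move \<sigma> ys) = move \<sigma> (map2 f xs ys)"
  using assms permutes_inv[OF assms(1)]
  by (simp add: move_def permute_list_map permute_list_zip)

text \<open>Permuting entries changes neither the length nor the sum. This reindexes the Cartan sum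
  when the tensor factors are permuted.\<close>

lemma bij_betw_move:
  assumes "\<sigma> permutes {..<n}"
  shows "bij_betw (move \<sigma>) {ks :: nat list. length ks = n \<and> sum_list ks = i}
    {ks. length ks = n \<and> sum_list ks = i}"
\<comment> \<open>\<open>move \<sigma>\<close> permutes by the inverse of \<open>\<sigma>\<close>,
  so its own inverse is \<open>permute_list \<sigma>\<close>.\<close>
proof (rule bij_betwI[where g = "permute_list \<sigma>"])
  have s: "sum_list (permute_list \<tau> ks) = sum_list ks"
    if "\<tau> permutes {..<n}" "length ks = n" for \<tau> and ks :: "nat list"
    using that by (metis mset_permute_list sum_mset_sum_list)
  note inv = permutes_inv[OF assms]
  show "move \<sigma> \<in> {ks. length ks = n \<and> sum_list ks = i} \<rightarrow> {ks. length ks = n \<and> sum_list ks = i}"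
    using s[OF inv] by (auto simp: move_def)
  show "permute_list \<sigma> \<in> {ks. length ks = n \<and> sum_list ks = i} \<rightarrow>
      {ks. length ks = n \<and> sum_list ks = i}"
    using s[OF assms] by auto
  fix ks :: "nat list" assume "ks \<in> {ks. length ks = n \<and> sum_list ks = i}"
  then have n: "n = length ks" by simp
  show "permute_list \<sigma> (move \<sigma> ks) = ks"
    using assms inv unfolding move_def n
    by (simp flip: permute_list_compose) (simp add: permutes_inv_o)
  show "move \<sigma> (permute_list \<sigma> ks) = ks"
    using assms inv unfolding move_def n
    by (simp flip: permute_list_compose) (simp add: permutes_inv_o)
qed

section \<open>Homogeneous decompositions\<close>

context graded_space
begin

sublocale V: Module.module F2 M by (rule vec_space)

lemma gr_carrier: "x \<in> gr M d \<Longrightarrow> x \<in> carrier M"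
  using gr_submodule[of d] V.submoduleE(1) by blast

lemma gr_zero: "\<zero>\<^bsub>M\<^esub> \<in> gr M d"
  using gr_submodule[of d] subgroup.one_closed by (force simp: submodule_def)

lemma gr_add: "x \<in> gr M d \<Longrightarrow> y \<in> gr M d \<Longrightarrow> x \<oplus>\<^bsub>M\<^esub> y \<in> gr M d"
  using gr_submodule[of d] V.submoduleE(5) by blast

text \<open>Allowing \<open>A\<close> to exceed the support of \<open>f\<close> means that supports
  never have to be determined exactly.\<close>

lemma decompositionI:
  assumes "finite A" "\<And>d. f d \<in> gr M d" "\<And>d. d \<notin> A \<Longrightarrow> f d = \<zero>\<^bsub>M\<^esub>"
  shows "homogeneous_decomposition M (finsum M f A) f"
proof -
  have "{d. f d \<noteq> \<zero>\<^bsub>M\<^esub>} \<subseteq> A" using assms by auto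
  moreover have "finsum M f {d. f d \<noteq> \<zero>\<^bsub>M\<^esub>} = finsum M f A"
    using assms gr_carrier calculation
    by (intro V.add.finprod_mono_neutral_cong_left) auto
  ultimately show ?thesis
    using assms finite_subset by (auto simp: homogeneous_decomposition_def)
qed

lemma decomposition_finsum:
  assumes "homogeneous_decomposition M x f" "finite A" "\<And>d. d \<notin> A \<Longrightarrow> f d = \<zero>\<^bsub>M\<^esub>"
  shows "x = finsum M f A"
proof -
  have "finsum M f {d. f d \<noteq> \<zero>\<^bsub>M\<^esub>} = finsum M f A"
    using assms gr_carrier
    by (intro V.add.finprod_mono_neutral_cong_left) (auto simp: homogeneous_decomposition_def)
  with assms show ?thesis by (simp add: homogeneous_decomposition_def)
qed

lemma homogeneous_decomposition_hom_part:
  "x \<in> carrier M \<Longrightarrow> homogeneous_decomposition M x (hom_part M x)"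
  unfolding hom_part_def by (rule theI'[OF direct_sum])

lemma hom_part_eqI:
  "x \<in> carrier M \<Longrightarrow> homogeneous_decomposition M x f \<Longrightarrow> hom_part M x = f"
  using direct_sum homogeneous_decomposition_hom_part by blast

lemma decomposition_add:
  assumes "homogeneous_decomposition M x f" "homogeneous_decomposition M y g"
  shows "homogeneous_decomposition M (x \<oplus>\<^bsub>M\<^esub> y) (\<lambda>d. f d \<oplus>\<^bsub>M\<^esub> g d)"
proof -
  \<comment> \<open>A common index set for both summands; the support of the sum may be strictly
    smaller because components can cancel.\<close>
  let ?A = "{d. f d \<noteq> \<zero>\<^bsub>M\<^esub>} \<union> {d. g d \<noteq> \<zero>\<^bsub>M\<^esub>}"
  have fin: "finite ?A" and gr: "f d \<in> gr M d" "g d \<in> gr M d" for d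
    using assms by (auto simp: homogeneous_decomposition_def)
  have "homogeneous_decomposition M (finsum M (\<lambda>d. f d \<oplus>\<^bsub>M\<^esub> g d) ?A) (\<lambda>d. f d \<oplus>\<^bsub>M\<^esub> g d)"
    using fin gr by (intro decompositionI) (auto intro: gr_add)
  moreover have "finsum M (\<lambda>d. f d \<oplus>\<^bsub>M\<^esub> g d) ?A = finsum M f ?A \<oplus>\<^bsub>M\<^esub> finsum M g ?A"
    using gr gr_carrier by (intro V.finsum_addf) auto
  moreover have "x = finsum M f ?A" "y = finsum M g ?A"
    using assms fin by (auto intro!: decomposition_finsum)
  ultimately show ?thesis by simp
qed

lemma decomposition_homogeneous:
  assumes "x \<in> gr M d"
  shows "homogeneous_decomposition M x (\<lambda>e. if e = d then x else \<zero>\<^bsub>M\<^esub>)"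
proof -
  have "homogeneous_decomposition M (finsum M (\<lambda>e. if e = d then x else \<zero>\<^bsub>M\<^esub>) {d})
      (\<lambda>e. if e = d then x else \<zero>\<^bsub>M\<^esub>)"
    using assms gr_zero by (intro decompositionI) auto
  moreover have "finsum M (\<lambda>e. if e = d then x else \<zero>\<^bsub>M\<^esub>) {d} = x"
    using assms gr_carrier by simp
  ultimately show ?thesis by simp
qed

text \<open>Every element is a finite sum of homogeneous components, so the property passes to it by
  induction on the set of degrees summed over.\<close>

lemma homogeneous_induct [consumes 1, case_names homogeneous add]:
  assumes x: "x \<in> carrier M"
    and hom: "\<And>d x. x \<in> gr M d \<Longrightarrow> Q x"
    and add: "\<And>x y. x \<in> carrier M \<Longrightarrow> y \<in> carrier M \<Longrightarrow> Q x \<Longrightarrow> Q y \<Longrightarrow> Q (x \<oplus>\<^bsub>M\<^esub> y)"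
  shows "Q x"
proof -
  from direct_sum[OF x] obtain f where f: "homogeneous_decomposition M x f" by blast
  then have gr: "f d \<in> gr M d" for d by (simp add: homogeneous_decomposition_def)
  have "Q (finsum M f A)" if "finite A" for A
    using that
  proof (induction A rule: finite_induct)
    case empty
    \<comment> \<open>The empty sum is zero, which is homogeneous of every degree.\<close>
    then show ?case using hom[OF gr_zero] by simp
  next
    case (insert d A)
    moreover have "f \<in> A \<rightarrow> carrier M" "f d \<in> carrier M" using gr gr_carrier by auto
    ultimately show ?case using add[OF _ _ hom[OF gr]] by simp
  qed
  then show ?thesis using f by (simp add: homogeneous_decomposition_def)
qed

end

section \<open>Linearity of the Steenrod operations and additivity of
  \<open>Sq_lower_0\<close>\<close>

context steenrod_module
begin

lemma Sq_closed [simp]: "x \<in> carrier M \<Longrightarrow> Sq M i x \<in> carrier M"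
  using Sq_linear[of i] by (auto simp: linear_map_def)

lemma Sq_add: "x \<in> carrier M \<Longrightarrow> y \<in> carrier M \<Longrightarrow> Sq M i (x \<oplus>\<^bsub>M\<^esub> y) = Sq M i x \<oplus>\<^bsub>M\<^esub> Sq M i y"
  using Sq_linear[of i] by (auto simp: linear_map_def)

lemma Sq_smult: "x \<in> carrier M \<Longrightarrow> Sq M i (c \<odot>\<^bsub>M\<^esub> x) = c \<odot>\<^bsub>M\<^esub> Sq M i x"
  using Sq_linear[of i] by (auto simp: linear_map_def)

lemma Sq_of_zero [simp]: "Sq M i \<zero>\<^bsub>M\<^esub> = \<zero>\<^bsub>M\<^esub>"
  using Sq_smult[of "\<zero>\<^bsub>M\<^esub>" i "\<zero>\<^bsub>F2\<^esub>"] by (simp add: V.smult_l_null)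

lemma map2_Sq_carrier: "set as \<subseteq> carrier M \<Longrightarrow> set (map2 (Sq M) ks as) \<subseteq> carrier M"
  by (auto dest: set_zip_rightD)

text \<open>Uniqueness of decompositions identifies \<open>hom_part M x\<close> with
  \<open>f\<close>; the degrees of \<open>A\<close> outside the support contribute Sq^d 0 = 0. Thus
  \<open>Sq_lower_0\<close> can be computed from any decomposition at hand.\<close>

lemma Sq_lower_0_decomposition:
  assumes "homogeneous_decomposition M x f" "finite A" "\<And>d. d \<notin> A \<Longrightarrow> f d = \<zero>\<^bsub>M\<^esub>"
  shows "Sq_lower_0 M x = (\<Oplus>\<^bsub>M\<^esub>d\<in>A. Sq M d (f d))"
proof -
  have gr: "f d \<in> carrier M" for d
    using assms(1) gr_carrier by (auto simp: homogeneous_decomposition_def)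
  have "x \<in> carrier M"
    using decomposition_finsum[OF assms] gr by simp
  then have "hom_part M x = f" using assms by (simp add: hom_part_eqI)
  then show ?thesis
    unfolding Sq_lower_0_def using assms gr
    by (intro V.add.finprod_mono_neutral_cong_left) auto
qed

lemma Sq_lower_0_homogeneous: "x \<in> gr M d \<Longrightarrow> Sq_lower_0 M x = Sq M d x"
  using Sq_lower_0_decomposition[OF decomposition_homogeneous, of x d "{d}"] gr_carrier by simp

text \<open>Decompositions add degreewise, and in each fixed degree d only the additive operation
  Sq^d is applied.\<close>

lemma Sq_lower_0_add:
  assumes "x \<in> carrier M" "y \<in> carrier M"
  shows "Sq_lower_0 M (x \<oplus>\<^bsub>M\<^esub> y) = Sq_lower_0 M x \<oplus>\<^bsub>M\<^esub> Sq_lower_0 M y"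
proof -
  from direct_sum assms obtain f g
    where fg: "homogeneous_decomposition M x f" "homogeneous_decomposition M y g" by metis
  let ?A = "{d. f d \<noteq> \<zero>\<^bsub>M\<^esub>} \<union> {d. g d \<noteq> \<zero>\<^bsub>M\<^esub>}"
  have fin: "finite ?A" and gr: "f d \<in> carrier M" "g d \<in> carrier M" for d
    using fg gr_carrier by (auto simp: homogeneous_decomposition_def)
  have "Sq_lower_0 M (x \<oplus>\<^bsub>M\<^esub> y) = (\<Oplus>\<^bsub>M\<^esub>d\<in>?A. Sq M d (f d \<oplus>\<^bsub>M\<^esub> g d))"
    using fin by (intro Sq_lower_0_decomposition decomposition_add fg) auto
  also have "\<dots> = (\<Oplus>\<^bsub>M\<^esub>d\<in>?A. Sq M d (f d)) \<oplus>\<^bsub>M\<^esub> (\<Oplus>\<^bsub>M\<^esub>d\<in>?A. Sq M d (g d))"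
    using gr by (simp add: Sq_add V.finsum_addf)
  also have "\<dots> = Sq_lower_0 M x \<oplus>\<^bsub>M\<^esub> Sq_lower_0 M y"
    using fin by (intro arg_cong2[where f = "add M"] Sq_lower_0_decomposition[symmetric] fg) auto
  finally show ?thesis .
qed

lemma Sq_lower_0_closed [simp]: "x \<in> carrier M \<Longrightarrow> Sq_lower_0 M x \<in> carrier M"
  by (induction rule: homogeneous_induct) (auto simp: Sq_lower_0_homogeneous Sq_lower_0_add gr_carrier)

section \<open>The Steenrod operations on classes of tensors\<close>

text \<open>This is what makes Sq^i well defined on the quotient. For each generating relation, the
  Cartan expansion is a sum over exponent lists of relations of the same kind; only coinvariance
  also requires reindexing the sum.\<close>

lemma cartan_Sq_relations:
  assumes "r \<in> tensor_relations P M"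
  shows "linear_extension (cartan_Sq M i) r \<in> tensor_relations P M"
  using assms
proof induction
  case zero
  then show ?case by (simp add: tensor_relations.zero)
next
  case (sum r s)
  then show ?case by (simp add: linear_extension_add tensor_relations.sum)
next
  case (add_op \<mu> as \<nu>)
  let ?K = "{ks. length ks = length as \<and> sum_list ks = i}"
  have "basis_tensor (\<mu> \<oplus>\<^bsub>ops P (length as)\<^esub> \<nu>) (map2 (Sq M) ks as) -
      basis_tensor \<mu> (map2 (Sq M) ks as) - basis_tensor \<nu> (map2 (Sq M) ks as) \<in> tensor_relations P M"
    if "ks \<in> ?K" for ks
    using tensor_relations.add_op[of \<mu> P "map2 (Sq M) ks as" \<nu> M] add_op that map2_Sq_carrier[of as ks]
    by simp
  from tensor_relations_sum[where A = ?K, OF this] show ?case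
    by (simp add: linear_extension_diff linear_extension_single cartan_Sq_def sum_subtractf)
next
  case (smult_op \<mu> as c)
  let ?K = "{ks. length ks = length as \<and> sum_list ks = i}"
  have "basis_tensor (c \<odot>\<^bsub>ops P (length as)\<^esub> \<mu>) (map2 (Sq M) ks as) -
      Poly_Mapping.single (\<mu>, map2 (Sq M) ks as) c \<in> tensor_relations P M"
    if "ks \<in> ?K" for ks
    using tensor_relations.smult_op[of \<mu> P "map2 (Sq M) ks as" M c] smult_op that map2_Sq_carrier[of as ks]
    by simp
  \<comment> \<open>The linear extension of a term with coefficient \<open>c\<close> is defined
    through its support, so \<open>c = 0\<close> and \<open>c = 1\<close> are treated
    separately.\<close>
  from tensor_relations_sum[where A = ?K, OF this] show ?case
    by (cases c) (simp_all add: linear_extension_diff linear_extension_single cartan_Sq_def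
        sum_subtractf)
next
  case (add_arg \<mu> as j x y)
  let ?K = "{ks. length ks = length as \<and> sum_list ks = i}"
  have "basis_tensor \<mu> (map2 (Sq M) ks (as[j := x \<oplus>\<^bsub>M\<^esub> y])) -
      basis_tensor \<mu> (map2 (Sq M) ks (as[j := x])) - basis_tensor \<mu> (map2 (Sq M) ks (as[j := y]))
      \<in> tensor_relations P M" if "ks \<in> ?K" for ks
  proof -
    \<comment> \<open>Place \<open>j\<close> is the only one affected, and there a single additive
      operation, of exponent \<open>ks ! j\<close>, acts on all three arguments.\<close>
    have upd: "map2 (Sq M) ks (as[j := z]) = (map2 (Sq M) ks as)[j := Sq M (ks ! j) z]" for z
      using that add_arg by (intro nth_equalityI) (auto simp: nth_list_update)
    show ?thesis
      using tensor_relations.add_arg[of \<mu> P "map2 (Sq M) ks as" M j "Sq M (ks ! j) x" "Sq M (ks ! j) y"]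
        add_arg that map2_Sq_carrier[of as ks]
      by (simp add: upd Sq_add)
  qed
  from tensor_relations_sum[where A = ?K, OF this] show ?case
    by (simp add: linear_extension_diff linear_extension_single cartan_Sq_def sum_subtractf)
next
  case (smult_arg \<mu> as j x c)
  let ?K = "{ks. length ks = length as \<and> sum_list ks = i}"
  have "basis_tensor \<mu> (map2 (Sq M) ks (as[j := c \<odot>\<^bsub>M\<^esub> x])) -
      Poly_Mapping.single (\<mu>, map2 (Sq M) ks (as[j := x])) c \<in> tensor_relations P M"
    if "ks \<in> ?K" for ks
  proof -
    have upd: "map2 (Sq M) ks (as[j := z]) = (map2 (Sq M) ks as)[j := Sq M (ks ! j) z]" for z
      using that smult_arg by (intro nth_equalityI) (auto simp: nth_list_update)
    show ?thesis
      using tensor_relations.smult_arg[of \<mu> P "map2 (Sq M) ks as" M j "Sq M (ks ! j) x" c]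
        smult_arg that map2_Sq_carrier[of as ks]
      by (simp add: upd Sq_smult)
  qed
  from tensor_relations_sum[where A = ?K, OF this] show ?case
    by (cases c) (simp_all add: linear_extension_diff linear_extension_single cartan_Sq_def
        sum_subtractf)
next
  case (coinvariant \<mu> as \<sigma>)
  let ?K = "{ks. length ks = length as \<and> sum_list ks = i}"
  have "basis_tensor (act P (length as) \<mu> \<sigma>) (map2 (Sq M) ks as) -
      basis_tensor \<mu> (map2 (Sq M) (move \<sigma> ks) (move \<sigma> as)) \<in> tensor_relations P M"
    if "ks \<in> ?K" for ks
    using tensor_relations.coinvariant[of \<mu> P "map2 (Sq M) ks as" M \<sigma>] coinvariant that map2_Sq_carrier[of as ks]
    by (simp add: map2_move)
  from tensor_relations_sum[where A = ?K, OF this] have "(\<Sum>ks\<in>?K. basis_tensor (act P (length as) \<mu> \<sigma>) (map2 (Sq M) ks as)) -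
      (\<Sum>ks\<in>?K. basis_tensor \<mu> (map2 (Sq M) (move \<sigma> ks) (move \<sigma> as))) \<in> tensor_relations P M"
    by (simp add: sum_subtractf)
  \<comment> \<open>Termwise, the exponents had to move together with the arguments. In the total
    this is invisible, since \<open>\<sigma>\<close> permutes the exponent lists of the given
    sum.\<close>
  moreover have "(\<Sum>ks\<in>?K. basis_tensor \<mu> (map2 (Sq M) (move \<sigma> ks) (move \<sigma> as))) =
      (\<Sum>ks\<in>?K. basis_tensor \<mu> (map2 (Sq M) ks (move \<sigma> as)))"
    by (rule sum.reindex_bij_betw[OF bij_betw_move[OF coinvariant(3)]])
  ultimately show ?case
    by (simp add: linear_extension_diff linear_extension_single cartan_Sq_def)
qed

text \<open>The chosen representative differs from \<open>u\<close> by a relation, which the Cartan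
  expansion sends to a relation.\<close>

lemma schur_Sq:
  "Sq (schur P M) i (tensor_class P M u) = tensor_class P M (linear_extension (cartan_Sq M i) u)"
  using cartan_Sq_relations[OF rep_tensor_class[of P M u]]
  by (simp add: schur_def linear_extension_diff tensor_class_eqI)

end

section \<open>The Cartan formula in the top degree of an unstable module\<close>

text \<open>Otherwise \<open>ks\<close> would lie below \<open>ds\<close> entrywise and strictly
  below it somewhere, making its sum smaller.\<close>

lemma exceeding_entry:
  fixes ks ds :: "nat list"
  assumes "length ks = length ds" "sum_list ks = sum_list ds" "ks \<noteq> ds"
  shows "\<exists>j<length ds. ds ! j < ks ! j"
proof (rule ccontr)
  assume "\<not> ?thesis"
  then have le: "\<And>j. j < length ds \<Longrightarrow> ks ! j \<le> ds ! j" by force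
  obtain j where j: "j < length ds" "ks ! j \<noteq> ds ! j"
    using assms(1,3) nth_equalityI by metis
  have "(\<Sum>j<length ds. ks ! j) < (\<Sum>j<length ds. ds ! j)"
    using j le by (intro sum_strict_mono_ex1) (auto intro!: bexI[of _ j] simp: le_neq_implies_less)
  then show False using assms(1,2) by (simp add: sum_list_sum_nth atLeast0LessThan)
qed

context unstable_module
begin

text \<open>The statement is modulo relations because the discarded terms are nonzero as formal
  sums: each is a basis tensor with a zero entry, and only its class vanishes.\<close>

lemma cartan_Sq_top_degree:
  assumes "\<mu> \<in> carrier (ops P (length as))" "list_all2 (\<lambda>d a. a \<in> gr M d) ds as"
  shows "cartan_Sq M (sum_list ds) (\<mu>, as) - basis_tensor \<mu> (map2 (Sq M) ds as)
    \<in> tensor_relations P M"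
proof -
  let ?K = "{ks. length ks = length as \<and> sum_list ks = sum_list ds}"
  have len: "length ds = length as" and gr: "\<And>j. j < length as \<Longrightarrow> as ! j \<in> gr M (ds ! j)"
    using assms(2) by (auto simp: list_all2_conv_all_nth)
  have carr: "set as \<subseteq> carrier M"
    using gr gr_carrier by (auto simp: set_conv_nth)
  have "basis_tensor \<mu> (map2 (Sq M) ks as) \<in> tensor_relations P M" if ks: "ks \<in> ?K - {ds}" for ks
  proof (rule zero_arg_relation)
    obtain j where j: "j < length ds" "ds ! j < ks ! j"
      using exceeding_entry[of ks ds] ks len by auto
    then have "map2 (Sq M) ks as ! j = \<zero>\<^bsub>M\<^esub>"
      using ks len gr unstable by auto
    then show "\<zero>\<^bsub>M\<^esub> \<in> set (map2 (Sq M) ks as)"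
      using j ks len nth_mem[of j "map2 (Sq M) ks as"] by simp
  qed (use vec_space assms ks map2_Sq_carrier[OF carr] in auto)
  then have "(\<Sum>ks\<in>?K - {ds}. basis_tensor \<mu> (map2 (Sq M) ks as)) \<in> tensor_relations P M"
    by (rule tensor_relations_sum)
  moreover have "cartan_Sq M (sum_list ds) (\<mu>, as) =
      basis_tensor \<mu> (map2 (Sq M) ds as) + (\<Sum>ks\<in>?K - {ds}. basis_tensor \<mu> (map2 (Sq M) ks as))"
    unfolding cartan_Sq_def using len by (simp add: sum.remove[OF finite_compositions, of ds])
  ultimately show ?thesis by simp
qed

end

section \<open>Operations on an unstable algebra\<close>

context unstable_algebra
begin

lemma tensor_class_carrier:
  "\<mu> \<in> carrier (ops P (length as)) \<Longrightarrow> set as \<subseteq> carrier M \<Longrightarrow>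
    tensor_class P M (basis_tensor \<mu> as) \<in> carrier (schur P M)"
  by (auto simp: schur_def basis_tensors_def)

lemma op_apply_closed:
  "\<mu> \<in> carrier (ops P (length as)) \<Longrightarrow> set as \<subseteq> carrier M \<Longrightarrow> op_apply P M \<theta> \<mu> as \<in> carrier M"
  unfolding op_apply_def
  by (rule funcset_mem[OF _ tensor_class_carrier])
    (use structure_hom in \<open>simp_all add: sq_module_hom_def linear_map_def\<close>)

text \<open>The list is split around the varying argument to match the later induction, which treats
  the last entry of a prefix.\<close>

lemma op_apply_add:
  assumes "\<mu> \<in> carrier (ops P (length (xs @ x # ys)))" "set (xs @ ys) \<subseteq> carrier M"
    "x \<in> carrier M" "y \<in> carrier M"
  shows "op_apply P M \<theta> \<mu> (xs @ (x \<oplus>\<^bsub>M\<^esub> y) # ys) =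
    op_apply P M \<theta> \<mu> (xs @ x # ys) \<oplus>\<^bsub>M\<^esub> op_apply P M \<theta> \<mu> (xs @ y # ys)"
proof -
  have "tensor_class P M (basis_tensor \<mu> (xs @ (x \<oplus>\<^bsub>M\<^esub> y) # ys)) =
      tensor_class P M (basis_tensor \<mu> (xs @ x # ys) + basis_tensor \<mu> (xs @ y # ys))"
    \<comment> \<open>Place \<open>length xs\<close> is the one between \<open>xs\<close> and
      \<open>ys\<close>, so updating it gives the three required lists.\<close>
    using tensor_relations.add_arg[of \<mu> P "xs @ x # ys" M "length xs" x y] assms
    by (intro tensor_class_eqI) (simp add: diff_diff_eq)
  also have "\<dots> = tensor_class P M (basis_tensor \<mu> (xs @ x # ys)) \<oplus>\<^bsub>schur P M\<^esub>
      tensor_class P M (basis_tensor \<mu> (xs @ y # ys))"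
    by (simp add: schur_add)
  finally show ?thesis
    using structure_hom assms tensor_class_carrier[of \<mu> "xs @ x # ys"]
      tensor_class_carrier[of \<mu> "xs @ y # ys"]
    by (simp add: op_apply_def sq_module_hom_def linear_map_def)
qed

text \<open>Operations have degree 0 and \<open>\<theta>\<close> preserves degrees, so the degrees
  of the arguments simply add.\<close>

lemma op_apply_gr:
  assumes "\<mu> \<in> carrier (ops P (length as))" "list_all2 (\<lambda>d a. a \<in> gr M d) ds as"
  shows "op_apply P M \<theta> \<mu> as \<in> gr M (sum_list ds)"
proof -
  have "tensor_class P M (basis_tensor \<mu> as) \<in> gr (schur P M) (sum_list ds)"
    using assms unfolding schur_def homogeneous_tensors_def
    by (auto intro!: imageI)
  then show ?thesis
    using structure_hom by (auto simp: op_apply_def sq_module_hom_def)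
qed

text \<open>Since \<open>\<theta>\<close> commutes with the Steenrod operations, the top square can
  be evaluated in \<open>schur P M\<close>, where the Cartan formula holds by construction.\<close>

lemma Sq_lower_0_op_apply_homogeneous:
  assumes "\<mu> \<in> carrier (ops P (length as))" "list_all2 (\<lambda>d a. a \<in> gr M d) ds as"
  shows "Sq_lower_0 M (op_apply P M \<theta> \<mu> as) = op_apply P M \<theta> \<mu> (map (Sq_lower_0 M) as)"
proof -
  have len: "length ds = length as" and gr: "\<And>j. j < length as \<Longrightarrow> as ! j \<in> gr M (ds ! j)"
    using assms(2) by (auto simp: list_all2_conv_all_nth)
  have carr: "set as \<subseteq> carrier M"
    using gr gr_carrier by (auto simp: set_conv_nth)
  have "Sq_lower_0 M (op_apply P M \<theta> \<mu> as) = Sq M (sum_list ds) (op_apply P M \<theta> \<mu> as)"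
    using assms by (intro Sq_lower_0_homogeneous op_apply_gr)
  also have "\<dots> = \<theta> (Sq (schur P M) (sum_list ds) (tensor_class P M (basis_tensor \<mu> as)))"
    using structure_hom tensor_class_carrier[OF assms(1) carr]
    by (simp add: op_apply_def sq_module_hom_def)
  also have "\<dots> = \<theta> (tensor_class P M (cartan_Sq M (sum_list ds) (\<mu>, as)))"
    by (simp add: schur_Sq linear_extension_single)
  also have "\<dots> = op_apply P M \<theta> \<mu> (map2 (Sq M) ds as)"
    unfolding op_apply_def using tensor_class_eqI[OF cartan_Sq_top_degree[OF assms]] by simp
  also have "map2 (Sq M) ds as = map (Sq_lower_0 M) as"
    using len gr by (intro nth_equalityI) (auto simp: Sq_lower_0_homogeneous[OF gr])
  finally show ?thesis .
qed

text \<open>Arbitrary entries \<open>xs\<close> are followed by homogeneous entries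
  \<open>ys\<close>. The induction shortens the prefix: its last entry is reduced to homogeneous
  ones by additivity and then joins the suffix, which is why \<open>ys\<close> and \<open>ds\<close>
  must vary.\<close>

lemma Sq_lower_0_op_apply_append:
  assumes "\<mu> \<in> carrier (ops P (length (xs @ ys)))" "set xs \<subseteq> carrier M"
    "list_all2 (\<lambda>d a. a \<in> gr M d) ds ys"
  shows "Sq_lower_0 M (op_apply P M \<theta> \<mu> (xs @ ys)) =
    op_apply P M \<theta> \<mu> (map (Sq_lower_0 M) (xs @ ys))"
  using assms
proof (induction xs arbitrary: ys ds rule: rev_induct)
  case Nil
  then show ?case using Sq_lower_0_op_apply_homogeneous by simp
next
  case (snoc x xs)
  have ys: "set ys \<subseteq> carrier M"
    using snoc.prems(3) gr_carrier by (fastforce simp: list_all2_conv_all_nth set_conv_nth)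
  have "x \<in> carrier M" using snoc.prems by simp
  then have "Sq_lower_0 M (op_apply P M \<theta> \<mu> (xs @ x # ys)) =
      op_apply P M \<theta> \<mu> (map (Sq_lower_0 M) (xs @ x # ys))"
  proof (induction rule: homogeneous_induct)
    case (homogeneous d x)
    then show ?case
      \<comment> \<open>The homogeneous entry moves across the boundary, together with its
        degree.\<close>
      using snoc.IH[of "x # ys" "d # ds"] snoc.prems by simp
  next
    case (add x y)
    have closed: "op_apply P M \<theta> \<mu> (xs @ z # ys) \<in> carrier M" if "z \<in> carrier M" for z
      using that snoc.prems ys by (intro op_apply_closed) auto
    have carr: "set (map (Sq_lower_0 M) xs @ map (Sq_lower_0 M) ys) \<subseteq> carrier M"
      using snoc.prems ys by auto
    have "Sq_lower_0 M (op_apply P M \<theta> \<mu> (xs @ (x \<oplus>\<^bsub>M\<^esub> y) # ys)) =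
        Sq_lower_0 M (op_apply P M \<theta> \<mu> (xs @ x # ys)) \<oplus>\<^bsub>M\<^esub>
        Sq_lower_0 M (op_apply P M \<theta> \<mu> (xs @ y # ys))"
      using add.hyps snoc.prems ys closed by (simp add: op_apply_add Sq_lower_0_add)
    \<comment> \<open>The right-hand side splits in the same way, as \<open>Sq_lower_0\<close> is
      additive and so is \<open>\<mu>\<close> in this argument.\<close>
    then show ?case
      using add snoc.prems carr by (simp add: op_apply_add Sq_lower_0_add)
  qed
  then show ?case by simp
qed

lemma Sq_lower_0_op_apply:
  assumes "\<mu> \<in> carrier (ops P (length as))" "set as \<subseteq> carrier M"
  shows "Sq_lower_0 M (op_apply P M \<theta> \<mu> as) = op_apply P M \<theta> \<mu> (map (Sq_lower_0 M) as)"
  using Sq_lower_0_op_apply_append[of \<mu> as "[]" "[]"] assms by simp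

end

theorem proposition5p6:
  fixes P :: "'p operad"
    and star :: 'p
    and M :: "'m sq_module"
    and \<theta> :: "('p, 'm) formal_tensor set \<Rightarrow> 'm"
  assumes "symmetric_operad P"
    and "star \<in> invariants P 2"
    and "star_unstable_algebra P star M \<theta>"
  shows "star_compatible P star M \<theta>"
proof -
  interpret star_unstable_algebra P star M \<theta> by (rule assms)
  show ?thesis
    unfolding star_compatible_def
  proof (intro allI ballI impI)
    fix n \<mu> as
    assume \<mu>: "\<mu> \<in> carrier (ops P n)" and as: "length as = n \<and> set as \<subseteq> carrier M"
    have "map (\<lambda>a. op_apply P M \<theta> star [a, a]) as = map (Sq_lower_0 M) as"
    proof (rule map_cong[OF refl])
      fix a assume "a \<in> set as"
      with as have "a \<in> carrier M" by blast
      then show "op_apply P M \<theta> star [a, a] = Sq_lower_0 M a" by (rule star_unstable[symmetric])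
    qed
    with \<mu> as have "Sq_lower_0 M (op_apply P M \<theta> \<mu> as) =
        op_apply P M \<theta> \<mu> (map (\<lambda>a. op_apply P M \<theta> star [a, a]) as)"
      using Sq_lower_0_op_apply[of \<mu> as] by argo
    \<comment> \<open>Closure allows \<open>star_unstable\<close> to be applied to the value of
      \<open>\<mu>\<close> itself, which turns the left-hand side into its
      \<open>Sq_lower_0\<close>.\<close>
    moreover have "op_apply P M \<theta> \<mu> as \<in> carrier M"
      using \<mu> as op_apply_closed[of \<mu> as] by blast
    ultimately show "op_apply P M \<theta> star [op_apply P M \<theta> \<mu> as, op_apply P M \<theta> \<mu> as] =
        op_apply P M \<theta> \<mu> (map (\<lambda>a. op_apply P M \<theta> star [a, a]) as)"
      using star_unstable by metis
  qed
qed

end
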